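(* Let $p_1,p_2$ be monic complex polynomials of degrees $d_1,d_2$ with distinct roots $\Lambda_1=\{\lambda_1,\dots,\lambda_{d_1}\}$ and $\Lambda_2=\{\mu_1,\dots,\mu_{d_2}\}$, let $M_1,M_2\subset\mathbb{C}$ be compact, and let $X=C(M_1\times M_2,\mathbb{C}^{d_1\times d_2})$, equipped with the polyproduct $\circledcirc$, the norm $|\cdot|_\infty$ and the operator norm $\|\cdot\|$. Then there is a constant $C$, depending only on $M_1\times M_2$ and $\Lambda_1,\Lambda_2$, such that for all $f,g\in X$ $$\|f\circledcirc g\|\le \|f\|\,\|g\|\qquad\text{and}\qquad |f|_\infty\le\|f\|\le C\,|f|_\infty .$$
   Context: Put $\sigma_{1,jl}=\frac{1}{p_1'(\lambda_l)}\frac{1}{\lambda_j-\lambda_l}$ for $j\ne l$ and $\sigma_{2,km}=\frac{1}{p_2'(\mu_m)}\frac{1}{\mu_k-\mu_m}$ for $k\neq m$. For functions $f,g: M_1\times M_2\to\mathbb{C}^{d_1\times d_2}$ with components $f_{j,k},g_{j,k}$ ($1\le j\le d_1$, $1\le k\le d_2$), the polyproduct $f\circledcirc g: M_1\times M_2\to\mathbb{C}^{d_1\times d_2}$ is defined at each $(w_1,w_2)$ by $$(f\circledcirc g)_{j,k}=f_{j,k}g_{j,k}-w_1\sum_{l\ne j}\sigma_{1,jl}(f_{j,k}-f_{l,k})(g_{j,k}-g_{l,k})-w_2\sum_{m\neq k}\sigma_{2,km}(f_{j,k}-f_{j,m})(g_{j,k}-g_{j,m})$$ $$\quad+w_1w_2\sum_{l\ne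 j,\,m\ne k}\sigma_{1,jl}\sigma_{2,km}\big((f_{j,k}-f_{j,m})-(f_{l,k}-f_{l,m})\big)\big((g_{j,k}-g_{j,m})-(g_{l,k}-g_{l,m})\big),$$ where all components are evaluated at $(w_1,w_2)$. Norms on $X$: $|f|_\infty=\max_{j,k}\max_{(w_1,w_2)\in M_1\times M_2}|f_{j,k}(w_1,w_2)|$, and $\|f\|=\sup_{g\in X,\ |g|_\infty\le 1}|f\circledcirc g|_\infty$. *)

theory Defs
  imports "HOL-Analysis.Analysis" "HOL-Computational_Algebra.Polynomial"
begin

text \<open>
  A family indexed by \<open>1, \<dots>, d\<close> is indexed by a finite type with \<open>d\<close> elements, so
  \<open>complex ^ 'n ^ 'm\<close> stands for the complex \<open>d1 \<times> d2\<close> matrices with \<open>d1 = CARD('m)\<close>,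
  \<open>d2 = CARD('n)\<close>, and \<open>f w $ j $ k\<close> is the component \<open>f\<^sub>j\<^sub>,\<^sub>k\<close> at \<open>w = (w1, w2)\<close>.
\<close>

definition sigma :: "complex poly \<Rightarrow> ('i \<Rightarrow> complex) \<Rightarrow> 'i \<Rightarrow> 'i \<Rightarrow> complex" where
  "sigma p r j l = 1 / poly (pderiv p) (r l) * (1 / (r j - r l))"

definition polyproduct ::
  "complex poly \<Rightarrow> complex poly \<Rightarrow> ('m::finite \<Rightarrow> complex) \<Rightarrow> ('n::finite \<Rightarrow> complex) \<Rightarrow>
   (complex \<times> complex \<Rightarrow> complex ^ 'n ^ 'm) \<Rightarrow> (complex \<times> complex \<Rightarrow> complex ^ 'n ^ 'm) \<Rightarrow>
   (complex \<times> complex \<Rightarrow> complex ^ 'n ^ 'm)" where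
  "polyproduct p1 p2 lam mu f g = (\<lambda>w. \<chi> j k.
      f w $ j $ k * g w $ j $ k
    - fst w * (\<Sum>l\<in>UNIV - {j}. sigma p1 lam j l
        * (f w $ j $ k - f w $ l $ k) * (g w $ j $ k - g w $ l $ k))
    - snd w * (\<Sum>m\<in>UNIV - {k}. sigma p2 mu k m
        * (f w $ j $ k - f w $ j $ m) * (g w $ j $ k - g w $ j $ m))
    + fst w * snd w * (\<Sum>l\<in>UNIV - {j}. \<Sum>m\<in>UNIV - {k}. sigma p1 lam j l * sigma p2 mu k m
        * ((f w $ j $ k - f w $ j $ m) - (f w $ l $ k - f w $ l $ m))
        * ((g w $ j $ k - g w $ j $ m) - (g w $ l $ k - g w $ l $ m))))"

text \<open>
  The space \<open>X = C(M, \<complex>\<^sup>d\<^sup>1\<^sup>\<times>\<^sup>d\<^sup>2)\<close>. Its elements are total functions, but everything below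
  depends only on their values on \<open>M\<close>.
\<close>

definition cont_space :: "(complex \<times> complex) set \<Rightarrow> (complex \<times> complex \<Rightarrow> complex ^ 'n ^ 'm) set" where
  "cont_space M = {f. continuous_on M f}"

text \<open>
  The norms take values in \<open>[0, \<infinity>]\<close>, so that suprema are meaningful without a prior proof of
  boundedness; in particular finiteness of the operator norm is not built in. For empty \<open>M\<close> both
  norms are \<open>0\<close>. For \<open>M\<close> compact and nonempty and \<open>f\<close> continuous, the supremum in \<open>sup_norm\<close> is an
  attained maximum, see \<open>sup_norm_attained\<close>.
\<close>

definition sup_norm ::
  "(complex \<times> complex) set \<Rightarrow> (complex \<times> complex \<Rightarrow> complex ^ 'n::finite ^ 'm::finite) \<Rightarrow> ennreal" where
  "sup_norm M f = (SUP j. SUP k. SUP w\<in>M. ennreal (cmod (f w $ j $ k)))"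

definition op_norm ::
  "complex poly \<Rightarrow> complex poly \<Rightarrow> ('m::finite \<Rightarrow> complex) \<Rightarrow> ('n::finite \<Rightarrow> complex) \<Rightarrow>
   (complex \<times> complex) set \<Rightarrow> (complex \<times> complex \<Rightarrow> complex ^ 'n ^ 'm) \<Rightarrow> ennreal" where
  "op_norm p1 p2 lam mu M f =
     (SUP g\<in>{g \<in> cont_space M. sup_norm M g \<le> 1}. sup_norm M (polyproduct p1 p2 lam mu f g))"

lemma sup_norm_attained:
  fixes f :: "complex \<times> complex \<Rightarrow> complex ^ 'n::finite ^ 'm::finite"
  assumes "compact M" "M \<noteq> {}" "f \<in> cont_space M"
  shows "\<exists>w\<in>M. \<exists>j k. sup_norm M f = ennreal (cmod (f w $ j $ k))
           \<and> (\<forall>v\<in>M. \<forall>i l. cmod (f v $ i $ l) \<le> cmod (f w $ j $ k))"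
proof -
  have "\<exists>w\<in>M. \<forall>v\<in>M. cmod (f v $ j $ k) \<le> cmod (f w $ j $ k)" for j k
    using assms by (intro continuous_attains_sup continuous_intros) (auto simp: cont_space_def)
  then obtain w where w: "\<And>j k. w j k \<in> M"
      "\<And>j k v. v \<in> M \<Longrightarrow> cmod (f v $ j $ k) \<le> cmod (f (w j k) $ j $ k)"
    by metis
  define h where "h = (\<lambda>(j, k). cmod (f (w j k) $ j $ k))"
  have "Max (range h) \<in> range h" by (rule Max_in) auto
  then obtain j k where jk: "h (j, k) = Max (range h)" by (metis rangeE surj_pair)
  have le: "cmod (f v $ i $ l) \<le> cmod (f (w j k) $ j $ k)" if "v \<in> M" for v i l
  proof -
    have "h (i, l) \<le> h (j, k)" unfolding jk by (rule Max_ge) auto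
    then show ?thesis using w(2)[OF that, of i l] by (simp add: h_def)
  qed
  have "sup_norm M f = ennreal (cmod (f (w j k) $ j $ k))"
  proof (rule antisym)
    show "sup_norm M f \<le> ennreal (cmod (f (w j k) $ j $ k))"
      unfolding sup_norm_def by (intro SUP_least ennreal_leI le)
    show "ennreal (cmod (f (w j k) $ j $ k)) \<le> sup_norm M f"
      unfolding sup_norm_def
      by (rule SUP_upper2[of j], simp, rule SUP_upper2[of k], simp, rule SUP_upper2[OF w(1)[of j k]], simp)
  qed
  with le w(1) show ?thesis by blast
qed

end

theory Submission
  imports Defs
begin

text \<open>
  In one variable, \<open>\<complex>\<^sup>d\<close> is identified with the polynomials of degree \<open>< d\<close> by evaluation at the
  roots of \<open>p\<close>, and the product at \<open>w\<close> becomes multiplication in \<open>\<complex>[x] / (p - w)\<close>: dividing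
  \<open>F G = p Q + K\<close> and comparing derivatives at the roots shows that \<open>Q\<close> takes the values
  \<open>- \<Sum>\<^sub>l \<sigma>\<^sub>j\<^sub>l (f\<^sub>j - f\<^sub>l) (g\<^sub>j - g\<^sub>l)\<close>. So the one-variable product is associative, and the polyproduct
  is the tensor product of two such algebras. Hence \<open>\<parallel>\<cdot>\<parallel>\<close> is the norm of the operator
  \<open>g \<mapsto> f \<circledcirc> g\<close> in an associative algebra with unit \<open>1\<close>, which gives submultiplicativity and
  \<open>|f|\<^sub>\<infinity> \<le> \<parallel>f\<parallel>\<close>; the upper bound follows from the triangle inequality, as \<open>p\<^sub>1\<close> and \<open>p\<^sub>2\<close> are
  determined by their roots.
\<close>

section \<open>The product in one variable\<close>

text \<open>The weights \<open>s\<close> are left abstract, since only associativity needs them to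
  come from a polynomial.\<close>

definition vecprod ::
  "('i \<Rightarrow> 'i \<Rightarrow> complex) \<Rightarrow> complex \<Rightarrow> ('i::finite \<Rightarrow> complex) \<Rightarrow> ('i \<Rightarrow> complex) \<Rightarrow> 'i \<Rightarrow> complex" where
  "vecprod s w u v = (\<lambda>j. u j * v j - w * (\<Sum>l\<in>UNIV - {j}. s j l * (u j - u l) * (v j - v l)))"

locale simple_roots =
  fixes p :: "complex poly" and r :: "'i::finite \<Rightarrow> complex"
  assumes monic: "lead_coeff p = 1" and degree_p: "degree p = CARD('i)"
    and inj_r: "inj r" and roots: "{z. poly p z = 0} = range r"
begin

lemma poly_root [simp]: "poly p (r j) = 0"
  using roots by blast

lemma p_nonzero: "p \<noteq> 0"
  using monic by auto

section \<open>Lagrange interpolation at the roots of \<open>p\<close>\<close>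

lemma poly_eq_0_if_vanishes:
  assumes "degree q < CARD('i)" "\<And>j. poly q (r j) = 0"
  shows "q = 0"
proof (rule ccontr)
  assume q: "q \<noteq> 0"
  have "CARD('i) = card (range r)" using inj_r by (simp add: card_image)
  also have "\<dots> \<le> card {z. poly q z = 0}"
    using assms(2) poly_roots_finite[OF q] by (intro card_mono) auto
  also have "\<dots> \<le> degree q" by (rule card_poly_roots_bound[OF q])
  finally show False using assms(1) by simp
qed

text \<open>Divided by \<open>poly (pderiv p) (r l)\<close>, this is the Lagrange basis polynomial
  that is 1 at \<open>r l\<close> and 0 at the other roots.\<close>

definition cofactor :: "'i \<Rightarrow> complex poly" where
  "cofactor l = p div [:- r l, 1:]"

lemma p_eq: "p = [:- r l, 1:] * cofactor l"
proof -
  have "[:- r l, 1:] dvd p" by (simp flip: poly_eq_0_iff_dvd)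
  then show ?thesis by (simp only: cofactor_def dvd_mult_div_cancel)
qed

lemma degree_cofactor: "degree (cofactor l) < CARD('i)"
proof -
  have "cofactor l \<noteq> 0" using p_eq[of l] p_nonzero by auto
  then have "degree p = 1 + degree (cofactor l)"
    by (subst p_eq[of l], subst degree_mult_eq) auto
  then show ?thesis using degree_p by simp
qed

lemma poly_cofactor_other: "j \<noteq> l \<Longrightarrow> poly (cofactor l) (r j) = 0"
  using arg_cong[OF p_eq[of l], of "\<lambda>q. poly q (r j)"] inj_r by (auto simp: inj_def)

lemma pderiv_p: "pderiv p = cofactor l + [:- r l, 1:] * pderiv (cofactor l)"
proof -
  have "pderiv p = pderiv ([:- r l, 1:] * cofactor l)" using p_eq by metis
  also have "\<dots> = cofactor l + [:- r l, 1:] * pderiv (cofactor l)"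
    by (simp add: pderiv_mult pderiv_pCons pderiv_diff pderiv_smult)
  finally show ?thesis .
qed

lemma poly_cofactor_self: "poly (cofactor l) (r l) = poly (pderiv p) (r l)"
  by (subst pderiv_p[of l]) simp

text \<open>Otherwise \<open>cofactor l\<close> would vanish at all roots of \<open>p\<close>, more
  of them than its degree allows.\<close>

lemma pderiv_nonzero: "poly (pderiv p) (r l) \<noteq> 0"
proof
  assume "poly (pderiv p) (r l) = 0"
  then have "poly (cofactor l) (r j) = 0" for j
    using poly_cofactor_other[of j l] poly_cofactor_self[of l] by (cases "j = l") auto
  then have "cofactor l = 0"
    using poly_eq_0_if_vanishes degree_cofactor by blast
  then show False using p_eq[of l] p_nonzero by simp
qed

text \<open>This is where \<open>sigma\<close> comes from: up to the factor
  \<open>poly (pderiv p) (r j)\<close> it is the derivative of a Lagrange basis polynomial at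
  another node. Differentiate \<open>p_eq\<close> at \<open>r j\<close>, where
  \<open>cofactor l\<close> vanishes.\<close>

lemma poly_pderiv_cofactor:
  assumes "j \<noteq> l"
  shows "poly (pderiv (cofactor l)) (r j) / poly (pderiv p) (r l) = poly (pderiv p) (r j) * sigma p r j l"
proof -
  have "poly (pderiv p) (r j) = (r j - r l) * poly (pderiv (cofactor l)) (r j)"
    by (subst pderiv_p[of l]) (simp add: poly_cofactor_other[OF assms] algebra_simps)
  moreover have "r j - r l \<noteq> 0" using assms inj_r by (auto simp: inj_def)
  ultimately show ?thesis by (simp add: sigma_def)
qed

definition interp :: "('i \<Rightarrow> complex) \<Rightarrow> complex poly" where
  "interp u = (\<Sum>l\<in>UNIV. smult (u l / poly (pderiv p) (r l)) (cofactor l))"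

lemma degree_interp: "degree (interp u) < CARD('i)"
  unfolding interp_def
  by (rule degree_sum_less) (auto simp: degree_cofactor)

lemma poly_interp [simp]: "poly (interp u) (r j) = u j"
proof -
  have "poly (interp u) (r j) = (\<Sum>l\<in>UNIV. if l = j then u l else 0)"
    unfolding interp_def poly_sum
    by (intro sum.cong) (auto simp: poly_cofactor_other poly_cofactor_self pderiv_nonzero)
  then show ?thesis by simp
qed

lemma interp_poly:
  assumes "degree F < CARD('i)"
  shows "interp (\<lambda>l. poly F (r l)) = F"
proof -
  have "interp (\<lambda>l. poly F (r l)) - F = 0"
    by (rule poly_eq_0_if_vanishes) (auto intro: degree_diff_less degree_interp assms)
  then show ?thesis by simp
qed

section \<open>Multiplication modulo \<open>p - [:w:]\<close> in terms of values at the
  roots\<close>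

lemma poly_pderiv_at_root:
  assumes "degree F < CARD('i)"
  shows "poly (pderiv F) (r j) =
    poly (pderiv p) (r j) * (\<Sum>l\<in>UNIV - {j}. sigma p r j l * (poly F (r l) - poly F (r j)))"
proof -
  let ?c = "poly F (r j)"
  \<comment> \<open>Subtracting the constant keeps the derivative and removes the term
    \<open>l = j\<close> of the interpolation formula, which \<open>poly_pderiv_cofactor\<close>
    does not cover.\<close>
  have "degree (F - [:?c:]) < CARD('i)"
    by (rule degree_diff_less) (use assms in auto)
  then have "F - [:?c:] = interp (\<lambda>l. poly F (r l) - ?c)"
    using interp_poly[of "F - [:?c:]"] by simp
  then have "pderiv F = pderiv (interp (\<lambda>l. poly F (r l) - ?c))"
    by (metis diff_zero pderiv_diff pderiv_singleton)
  also have "poly \<dots> (r j) = (\<Sum>l\<in>UNIV. (poly F (r l) - ?c) *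
      (poly (pderiv (cofactor l)) (r j) / poly (pderiv p) (r l)))"
    by (simp add: interp_def higher_pderiv_sum[of "Suc 0", simplified] poly_sum pderiv_smult)
  also have "\<dots> = (\<Sum>l\<in>UNIV - {j}. (poly F (r l) - ?c) *
      (poly (pderiv (cofactor l)) (r j) / poly (pderiv p) (r l)))"
    by (rule sum.mono_neutral_right) auto
  also have "\<dots> = (\<Sum>l\<in>UNIV - {j}. (poly F (r l) - ?c) * (poly (pderiv p) (r j) * sigma p r j l))"
    by (intro sum.cong) (auto simp: poly_pderiv_cofactor)
  finally show ?thesis by (simp add: sum_distrib_left mult_ac)
qed

text \<open>One division by \<open>p\<close> serves all \<open>w\<close>:
  \<open>F * G = p * Q + K\<close> is the same as \<open>(K + w Q) + (p - w) Q\<close>. As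
  \<open>Q\<close> also has degree below \<open>CARD('i)\<close>, the polynomial
  \<open>K + w Q\<close> is already reduced modulo \<open>p - w\<close>.\<close>

lemma mult_mod_shifted:
  assumes F: "degree F < CARD('i)" and G: "degree G < CARD('i)"
  obtains H Q where "F * G = H + (p - [:w:]) * Q" "degree H < CARD('i)"
    "(\<lambda>j. poly H (r j)) = vecprod (sigma p r) w (\<lambda>j. poly F (r j)) (\<lambda>j. poly G (r j))"
proof -
  define Q K where "Q = (F * G) div p" and "K = (F * G) mod p"
  have FG: "F * G = p * Q + K" by (simp add: Q_def K_def)
  have K: "degree K < CARD('i)"
    using degree_mod_less[OF p_nonzero, of "F * G"] degree_p by (auto simp: K_def)
  have Q: "degree Q < CARD('i)"
  proof (cases "Q = 0")
    case False
    then have "CARD('i) + degree Q = degree (p * Q)"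
      using p_nonzero by (simp add: degree_mult_eq degree_p)
    also have "p * Q = F * G - K" using FG by simp
    also have "degree \<dots> < CARD('i) + CARD('i)"
      by (rule degree_diff_less) (use K F G degree_mult_le[of F G] in linarith)+
    finally show ?thesis by simp
  qed simp
  have K_root: "poly K (r j) = poly F (r j) * poly G (r j)" for j
    using arg_cong[OF FG, of "\<lambda>q. poly q (r j)"] by simp
  have Q_root: "poly Q (r j) = - (\<Sum>l\<in>UNIV - {j}. sigma p r j l *
      (poly F (r j) - poly F (r l)) * (poly G (r j) - poly G (r l)))" (is "_ = - ?S") for j
  proof -
    let ?D = "\<lambda>F. \<Sum>l\<in>UNIV - {j}. sigma p r j l * (poly F (r l) - poly F (r j))"
    \<comment> \<open>The value of \<open>Q\<close> at a root is lost in
      \<open>F * G = p * Q + K\<close> itself, but survives in the derivative: there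
      \<open>p * Q\<close> contributes \<open>p' Q\<close> with \<open>p'\<close> nonzero.\<close>
    have "poly F (r j) * poly (pderiv G) (r j) + poly (pderiv F) (r j) * poly G (r j)
        = poly (pderiv p) (r j) * poly Q (r j) + poly (pderiv K) (r j)"
      using arg_cong[OF FG, of "\<lambda>q. poly (pderiv q) (r j)"]
      by (simp add: pderiv_mult pderiv_add algebra_simps)
    then have "poly (pderiv p) (r j) * poly Q (r j) = poly (pderiv p) (r j) *
        (poly F (r j) * ?D G + ?D F * poly G (r j) - ?D K)"
      unfolding poly_pderiv_at_root[OF F] poly_pderiv_at_root[OF G] poly_pderiv_at_root[OF K]
      by algebra
    \<comment> \<open>Summand by summand: f_j (g_l - g_j) + (f_l - f_j) g_j - (f_l g_l - f_j g_j) =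
      - (f_j - f_l)(g_j - g_l).\<close>
    also have "poly F (r j) * ?D G + ?D F * poly G (r j) - ?D K = - ?S"
      unfolding K_root sum_distrib_left sum_distrib_right sum_negf[symmetric]
        sum.distrib[symmetric] sum_subtractf[symmetric]
      by (intro sum.cong) (simp_all add: algebra_simps)
    finally show ?thesis using pderiv_nonzero[of j] by (simp only: mult_cancel_left) simp
  qed
  show ?thesis
  proof
    show "F * G = (K + smult w Q) + (p - [:w:]) * Q"
      by (simp add: FG algebra_simps)
    show "degree (K + smult w Q) < CARD('i)"
      by (rule degree_add_less) (use K Q in \<open>auto intro: le_less_trans[OF degree_smult_le]\<close>)
    show "(\<lambda>j. poly (K + smult w Q) (r j)) =
        vecprod (sigma p r) w (\<lambda>j. poly F (r j)) (\<lambda>j. poly G (r j))"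
      by (simp add: vecprod_def K_root Q_root)
  qed
qed

text \<open>Both sides interpolate to remainders, \<open>C\<close> and \<open>D\<close>, of the same
  triple product modulo \<open>p - w\<close>. Their difference is a multiple of \<open>p - w\<close>
  of smaller degree, hence zero.\<close>

lemma vecprod_assoc:
  "vecprod (sigma p r) w (vecprod (sigma p r) w u v) x
    = vecprod (sigma p r) w u (vecprod (sigma p r) w v x)"
proof -
  obtain A Q1 where A: "interp u * interp v = A + (p - [:w:]) * Q1" "degree A < CARD('i)"
      "(\<lambda>j. poly A (r j)) = vecprod (sigma p r) w u v"
    using mult_mod_shifted[OF degree_interp degree_interp] by (metis (no_types) poly_interp ext)
  obtain B Q2 where B: "interp v * interp x = B + (p - [:w:]) * Q2" "degree B < CARD('i)"
      "(\<lambda>j. poly B (r j)) = vecprod (sigma p r) w v x"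
    using mult_mod_shifted[OF degree_interp degree_interp] by (metis (no_types) poly_interp ext)
  obtain C Q3 where C: "A * interp x = C + (p - [:w:]) * Q3" "degree C < CARD('i)"
      "(\<lambda>j. poly C (r j)) = vecprod (sigma p r) w (vecprod (sigma p r) w u v) x"
    using mult_mod_shifted[OF A(2) degree_interp[of x], of w] unfolding A(3) poly_interp by metis
  obtain D Q4 where D: "interp u * B = D + (p - [:w:]) * Q4" "degree D < CARD('i)"
      "(\<lambda>j. poly D (r j)) = vecprod (sigma p r) w u (vecprod (sigma p r) w v x)"
    using mult_mod_shifted[OF degree_interp[of u] B(2), of w] unfolding B(3) poly_interp by metis
  have "C - D = (A * interp x - (p - [:w:]) * Q3) - (interp u * B - (p - [:w:]) * Q4)"
    using C(1) D(1) by simp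
  also have "A = interp u * interp v - (p - [:w:]) * Q1" using A(1) by simp
  also have "B = interp v * interp x - (p - [:w:]) * Q2" using B(1) by simp
  finally have "C - D = (p - [:w:]) * (Q4 - Q3 - Q1 * interp x + interp u * Q2)"
    by (simp add: algebra_simps)
  then have dvd: "p - [:w:] dvd C - D" by simp
  \<comment> \<open>Shifting by a constant keeps the degree because \<open>CARD('i)\<close> is
    positive.\<close>
  have "p - [:w:] = p + [:- w:]" by simp
  then have "degree (p - [:w:]) = CARD('i)"
    using degree_add_eq_left[of "[:- w:]" p] degree_p by (metis degree_pCons_0 zero_less_card_finite)
  moreover have "degree (C - D) < CARD('i)" by (rule degree_diff_less[OF C(2) D(2)])
  ultimately have "C - D = 0" using dvd_imp_degree_le[OF dvd] by fastforce
  then have "C = D" by simp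
  with C(3) D(3) show ?thesis by metis
qed

end

section \<open>Dependence of \<sigma> on the set of roots alone\<close>

lemma simple_roots_unique:
  assumes "simple_roots p (r :: 'i::finite \<Rightarrow> complex)" "simple_roots q (s :: 'i \<Rightarrow> complex)"
    and "range r = range s"
  shows "p = q"
proof -
  interpret P: simple_roots p r by fact
  interpret Q: simple_roots q s by fact
  \<comment> \<open>The monic leading terms cancel, so the difference has too small a degree to
    vanish at all the common roots.\<close>
  have "coeff (p - q) CARD('i) = 0"
    using P.monic Q.monic P.degree_p Q.degree_p by simp
  moreover have "degree (p - q) \<le> CARD('i)"
    using P.degree_p Q.degree_p degree_diff_le by (metis order_refl)
  ultimately have "degree (p - q) < CARD('i)"
    using leading_coeff_neq_0[of "p - q"] by (cases "p = q") (auto simp: le_less)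
  moreover have "poly (p - q) (r j) = 0" for j
  proof -
    have "r j \<in> range s" using assms(3) by blast
    then show ?thesis by auto
  qed
  ultimately have "p - q = 0" by (rule P.poly_eq_0_if_vanishes)
  then show ?thesis by simp
qed

text \<open>The bound is chosen before the polynomial and the enumeration of its roots, so that the
  final constant depends on \<Lambda> only. All admissible \<open>p\<close> coincide, and reordering
  the roots merely permutes the values of one function on the finite set \<Lambda> \<times>
  \<Lambda>; the sum of their moduli is a bound. On the diagonal both sides are 0, as division by
  zero gives 0.\<close>

lemma sigma_bounded:
  "\<exists>B\<ge>0. \<forall>p (r :: 'i::finite \<Rightarrow> complex). simple_roots p r \<and> range r = \<Lambda> \<longrightarrow>
     (\<forall>j l. cmod (sigma p r j l) \<le> B)"
proof (cases "\<exists>p (r :: 'i \<Rightarrow> complex). simple_roots p r \<and> range r = \<Lambda>")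
  case True
  then obtain q and s :: "'i \<Rightarrow> complex" where q: "simple_roots q s" "range s = \<Lambda>" by blast
  let ?h = "\<lambda>(a, b). cmod (1 / poly (pderiv q) b * (1 / (a - b)))"
  have fin: "finite (\<Lambda> \<times> \<Lambda>)" using q(2) by (metis finite_cartesian_product finite finite_imageI)
  have "cmod (sigma p r j l) \<le> sum ?h (\<Lambda> \<times> \<Lambda>)"
    if "simple_roots p r" "range r = \<Lambda>" for p and r :: "'i \<Rightarrow> complex" and j l
  proof -
    have "p = q" using simple_roots_unique that q by metis
    then have "cmod (sigma p r j l) = ?h (r j, r l)" by (simp add: sigma_def)
    also have "\<dots> \<le> sum ?h (\<Lambda> \<times> \<Lambda>)"
      using that(2) by (intro member_le_sum fin) auto
    finally show ?thesis .
  qed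
  moreover have "sum ?h (\<Lambda> \<times> \<Lambda>) \<ge> 0" by (rule sum_nonneg) auto
  ultimately show ?thesis by blast
qed auto

section \<open>The product of matrices\<close>

text \<open>The polyproduct acts pointwise, so its algebra can be studied for matrices at one fixed
  point \<open>(w, z)\<close>.\<close>

definition matprod ::
  "('m \<Rightarrow> 'm \<Rightarrow> complex) \<Rightarrow> ('n \<Rightarrow> 'n \<Rightarrow> complex) \<Rightarrow> complex \<Rightarrow> complex \<Rightarrow>
   complex ^ 'n::finite ^ 'm::finite \<Rightarrow> complex ^ 'n ^ 'm \<Rightarrow> complex ^ 'n ^ 'm" where
  "matprod s t w z x y = (\<chi> j k.
      x $ j $ k * y $ j $ k
    - w * (\<Sum>l\<in>UNIV - {j}. s j l * (x $ j $ k - x $ l $ k) * (y $ j $ k - y $ l $ k))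
    - z * (\<Sum>m\<in>UNIV - {k}. t k m * (x $ j $ k - x $ j $ m) * (y $ j $ k - y $ j $ m))
    + w * z * (\<Sum>l\<in>UNIV - {j}. \<Sum>m\<in>UNIV - {k}. s j l * t k m
        * ((x $ j $ k - x $ j $ m) - (x $ l $ k - x $ l $ m))
        * ((y $ j $ k - y $ j $ m) - (y $ l $ k - y $ l $ m))))"

lemma polyproduct_eq_matprod:
  "polyproduct p1 p2 lam mu f g w =
     matprod (sigma p1 lam) (sigma p2 mu) (fst w) (snd w) (f w) (g w)"
  by (simp add: polyproduct_def matprod_def)

lemma matprod_commute: "matprod s t w z x y = matprod s t w z y x"
  by (simp add: matprod_def mult_ac)

lemma matprod_add_left:
  "matprod s t w z (x + x') y = matprod s t w z x y + matprod s t w z x' y"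
proof -
  have *: "a * (x1 + x1' - (x2 + x2')) * b = a * (x1 - x2) * b + a * (x1' - x2') * b"
    for a b x1 x2 x1' x2' :: complex by (simp add: algebra_simps)
  have **: "a * (x1 + x1' - (x2 + x2') - (x3 + x3' - (x4 + x4'))) * b
      = a * (x1 - x2 - (x3 - x4)) * b + a * (x1' - x2' - (x3' - x4')) * b"
    for a b x1 x2 x1' x2' x3 x3' x4 x4' :: complex by (simp add: algebra_simps)
  show ?thesis
    by (simp add: matprod_def vec_eq_iff * ** sum.distrib) (simp add: algebra_simps)
qed

lemma matprod_add_right:
  "matprod s t w z x (y + y') = matprod s t w z x y + matprod s t w z x y'"
  by (metis matprod_add_left matprod_commute)

lemma matprod_scaleR_right: "matprod s t w z x (c *\<^sub>R y) = c *\<^sub>R matprod s t w z x y"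
proof -
  have *: "a * (c *\<^sub>R y1 - c *\<^sub>R y2) = c *\<^sub>R (a * (y1 - y2))" for a y1 y2 :: complex
    by (simp add: scaleR_conv_of_real algebra_simps)
  have **: "a * (c *\<^sub>R y1 - c *\<^sub>R y2 - (c *\<^sub>R y3 - c *\<^sub>R y4)) = c *\<^sub>R (a * (y1 - y2 - (y3 - y4)))"
    for a y1 y2 y3 y4 :: complex by (simp add: scaleR_conv_of_real algebra_simps)
  show ?thesis
    by (simp add: matprod_def vec_eq_iff * ** scaleR_diff_right scaleR_add_right
        flip: scaleR_sum_right)
qed

lemma matprod_one_right: "matprod s t w z x (\<chi> j k. 1) = x"
  by (simp add: matprod_def vec_eq_iff)

section \<open>Elementary tensors and associativity\<close>

definition outer :: "('m \<Rightarrow> complex) \<Rightarrow> ('n \<Rightarrow> complex) \<Rightarrow> complex ^ 'n::finite ^ 'm::finite" where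
  "outer u v = (\<chi> j k. u j * v k)"

text \<open>The four terms of \<open>matprod\<close> are those of the expanded product (u_j u'_j - w
  S)(v_k v'_k - z T), with \<open>S\<close> and \<open>T\<close> the two one-variable sums. In
  particular the mixed second differences factor.\<close>

lemma matprod_outer:
  "matprod s t w z (outer u v) (outer u' v') = outer (vecprod s w u u') (vecprod t z v v')"
proof -
  have "matprod s t w z (outer u v) (outer u' v') $ j $ k
      = outer (vecprod s w u u') (vecprod t z v v') $ j $ k" for j k
  proof -
    let ?S = "\<Sum>l\<in>UNIV - {j}. s j l * (u j - u l) * (u' j - u' l)"
    let ?T = "\<Sum>m\<in>UNIV - {k}. t k m * (v k - v m) * (v' k - v' m)"
    have S: "(\<Sum>l\<in>UNIV - {j}. s j l * (u j * v k - u l * v k) * (u' j * v' k - u' l * v' k))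
        = v k * v' k * ?S"
      unfolding sum_distrib_left by (intro sum.cong) (simp_all add: algebra_simps)
    have T: "(\<Sum>m\<in>UNIV - {k}. t k m * (u j * v k - u j * v m) * (u' j * v' k - u' j * v' m))
        = u j * u' j * ?T"
      unfolding sum_distrib_left by (intro sum.cong) (simp_all add: algebra_simps)
    have "(u j * v k - u j * v m) - (u l * v k - u l * v m) = (u j - u l) * (v k - v m)"
      "(u' j * v' k - u' j * v' m) - (u' l * v' k - u' l * v' m) = (u' j - u' l) * (v' k - v' m)"
      for l m by (simp_all add: algebra_simps)
    then have ST: "(\<Sum>l\<in>UNIV - {j}. \<Sum>m\<in>UNIV - {k}. s j l * t k m
        * ((u j * v k - u j * v m) - (u l * v k - u l * v m))
        * ((u' j * v' k - u' j * v' m) - (u' l * v' k - u' l * v' m))) = ?S * ?T"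
      unfolding sum_product by (simp add: mult_ac)
    show ?thesis
      by (simp add: matprod_def outer_def vecprod_def S T ST del: sum_diff1) (simp add: algebra_simps)
  qed
  then show ?thesis by (simp add: vec_eq_iff)
qed

text \<open>The entry is put into the first tensor factor, so that maps can be compared on
  elementary tensors by additivity alone, without scalars.\<close>

lemma sum_outer:
  fixes x :: "complex ^ 'n::finite ^ 'm::finite"
  shows "x = (\<Sum>a\<in>UNIV. \<Sum>b\<in>UNIV.
    outer (\<lambda>j. if j = a then x $ a $ b else 0) (\<lambda>k. if k = b then 1 else 0))"
proof -
  have "(\<Sum>b\<in>UNIV. c b * (if k = b then 1 else 0)) = c k" for c :: "'n \<Rightarrow> complex" and k
    by (simp add: if_distrib[of "\<lambda>e. _ * e"] cong: if_cong)
  then show ?thesis by (simp add: vec_eq_iff outer_def)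
qed

lemma additive_eqI_outer:
  fixes F G :: "complex ^ 'n::finite ^ 'm::finite \<Rightarrow> complex ^ 'n ^ 'm"
  assumes "Modules.additive F" "Modules.additive G" and "\<And>u v. F (outer u v) = G (outer u v)"
  shows "F x = G x"
proof -
  note sum = Modules.additive.sum[OF assms(1)] Modules.additive.sum[OF assms(2)]
  show ?thesis
    using arg_cong[OF sum_outer[of x], of F] arg_cong[OF sum_outer[of x], of G]
    by (simp only: sum assms(3))
qed

text \<open>On elementary tensors this is associativity in each variable. It extends to arbitrary
  matrices one argument at a time, from the third to the first, because both sides are additive in
  each argument.\<close>

lemma matprod_assoc:
  fixes x y v :: "complex ^ 'n::finite ^ 'm::finite" and w z :: complex
  assumes "simple_roots p lam" "simple_roots q mu"
  defines "P \<equiv> matprod (sigma p lam) (sigma q mu) w z"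
  shows "P (P x y) v = P x (P y v)"
proof -
  note add = P_def Modules.additive_def matprod_add_left matprod_add_right
  have "P (P (outer a a') (outer b b')) (outer c c') = P (outer a a') (P (outer b b') (outer c c'))"
    for a a' b b' c c'
    using assms(1,2)[THEN simple_roots.vecprod_assoc] by (simp add: P_def matprod_outer)
  then have "P (P (outer a a') (outer b b')) v = P (outer a a') (P (outer b b') v)" for a a' b b' v
    by - (rule additive_eqI_outer[of "P (P (outer a a') (outer b b'))"
          "\<lambda>v. P (outer a a') (P (outer b b') v)"],
        auto simp: add)
  then have "P (P (outer a a') y) v = P (outer a a') (P y v)" for a a' y v
    by - (rule additive_eqI_outer[of "\<lambda>y. P (P (outer a a') y) v" "\<lambda>y. P (outer a a') (P y v)"],
        auto simp: add)
  then show ?thesis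
    by - (rule additive_eqI_outer[of "\<lambda>x. P (P x y) v" "\<lambda>x. P x (P y v)"], auto simp: add)
qed

text \<open>First differences at most double a bound and mixed second differences at most quadruple
  it. Products of two differences thus cost 4 and 16, so the bounds of the four terms are exactly
  the expansion of the stated product.\<close>

lemma cmod_matprod_le:
  fixes x y :: "complex ^ 'n::finite ^ 'm::finite"
  assumes s: "\<And>j l. cmod (s j l) \<le> B1" and t: "\<And>k m. cmod (t k m) \<le> B2"
    and w: "cmod w \<le> R1" and z: "cmod z \<le> R2"
    and x: "\<And>j k. cmod (x $ j $ k) \<le> a" and y: "\<And>j k. cmod (y $ j $ k) \<le> b"
  shows "cmod (matprod s t w z x y $ j $ k)
    \<le> (1 + 4 * R1 * CARD('m) * B1) * (1 + 4 * R2 * CARD('n) * B2) * (a * b)"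
proof -
  have nn: "0 \<le> a" "0 \<le> b" "0 \<le> B1" "0 \<le> B2" "0 \<le> R1" "0 \<le> R2"
    using s t w z x y norm_ge_zero order_trans by blast+
  have d1: "cmod (c - d) \<le> 2 * e" if "cmod c \<le> e" "cmod d \<le> e" for c d e
    using norm_triangle_ineq4[of c d] that by linarith
  have d2: "cmod (c - d - (c' - d')) \<le> 4 * e"
    if "cmod c \<le> e" "cmod d \<le> e" "cmod c' \<le> e" "cmod d' \<le> e" for c d c' d' e
    using d1[OF d1[OF that(1,2)] d1[OF that(3,4)]] by simp
  have sum_le: "cmod (sum h (UNIV - {i})) \<le> real CARD('i) * e" if "\<And>l. cmod (h l) \<le> e"
    for h :: "'i::finite \<Rightarrow> complex" and i e
  proof -
    have "0 \<le> e" using that norm_ge_zero order_trans by blast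
    have "cmod (sum h (UNIV - {i})) \<le> real (card (UNIV - {i})) * e"
      by (rule sum_norm_bound) (rule that)
    also have "\<dots> \<le> real CARD('i) * e"
      using \<open>0 \<le> e\<close> by (intro mult_right_mono) (auto intro: card_mono)
    finally show ?thesis .
  qed
  have "cmod (x $ j $ k * y $ j $ k) \<le> a * b"
    unfolding norm_mult by (intro mult_mono x y nn norm_ge_zero)
  moreover have "cmod (w * (\<Sum>l\<in>UNIV - {j}. s j l * (x $ j $ k - x $ l $ k) * (y $ j $ k - y $ l $ k)))
      \<le> R1 * (CARD('m) * (B1 * (2 * a) * (2 * b)))"
    unfolding norm_mult[of w]
    by (intro mult_mono w sum_le nn norm_ge_zero)
      (unfold norm_mult, intro mult_mono s d1 x y norm_ge_zero mult_nonneg_nonneg nn, auto simp: nn)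
  moreover have "cmod (z * (\<Sum>m\<in>UNIV - {k}. t k m * (x $ j $ k - x $ j $ m) * (y $ j $ k - y $ j $ m)))
      \<le> R2 * (CARD('n) * (B2 * (2 * a) * (2 * b)))"
    unfolding norm_mult[of z]
    by (intro mult_mono z sum_le nn norm_ge_zero)
      (unfold norm_mult, intro mult_mono t d1 x y norm_ge_zero mult_nonneg_nonneg nn, auto simp: nn)
  moreover have "cmod (w * z * (\<Sum>l\<in>UNIV - {j}. \<Sum>m\<in>UNIV - {k}. s j l * t k m
        * ((x $ j $ k - x $ j $ m) - (x $ l $ k - x $ l $ m))
        * ((y $ j $ k - y $ j $ m) - (y $ l $ k - y $ l $ m))))
      \<le> R1 * R2 * (CARD('m) * (CARD('n) * (B1 * B2 * (4 * a) * (4 * b))))"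
    unfolding norm_mult[of "w * z"] norm_mult[of w z]
    by (intro mult_mono w z sum_le nn norm_ge_zero mult_nonneg_nonneg)
      (unfold norm_mult, intro mult_mono s t d2 x y norm_ge_zero mult_nonneg_nonneg nn, auto simp: nn)
  moreover have "cmod (A - B - C + D) \<le> cmod A + cmod B + cmod C + cmod D" for A B C D
    using norm_triangle_ineq[of "A - B - C" D] norm_triangle_ineq4[of "A - B" C]
      norm_triangle_ineq4[of A B] by linarith
  ultimately have "cmod (matprod s t w z x y $ j $ k) \<le> a * b + R1 * (CARD('m) * (B1 * (2 * a) * (2 * b)))
      + R2 * (CARD('n) * (B2 * (2 * a) * (2 * b)))
      + R1 * R2 * (CARD('m) * (CARD('n) * (B1 * B2 * (4 * a) * (4 * b))))"
    unfolding matprod_def by (simp del: sum_diff1) (smt (verit, best))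
  then show ?thesis by (simp add: algebra_simps)
qed

section \<open>The norms\<close>

lemma sup_norm_le_iff: "sup_norm M f \<le> e \<longleftrightarrow> (\<forall>w\<in>M. \<forall>j k. ennreal (cmod (f w $ j $ k)) \<le> e)"
  by (auto simp: sup_norm_def SUP_le_iff)

lemma cmod_le_sup_norm: "w \<in> M \<Longrightarrow> ennreal (cmod (f w $ j $ k)) \<le> sup_norm M f"
  using sup_norm_le_iff[of M f "sup_norm M f"] by simp

lemma sup_norm_finite:
  assumes "compact M" "f \<in> cont_space M"
  obtains a where "0 \<le> a" "sup_norm M f = ennreal a"
proof (cases "M = {}")
  case True
  \<comment> \<open>The empty supremum in \<open>ennreal\<close> is 0.\<close>
  then have "sup_norm M f = ennreal 0" by (simp add: sup_norm_def bot_ennreal)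
  then show ?thesis using that by blast
next
  case False
  then show ?thesis using sup_norm_attained[OF assms(1) False assms(2)] that norm_ge_zero by metis
qed

lemma sup_norm_scaleR_le:
  assumes "0 \<le> c"
  shows "sup_norm M (\<lambda>w. c *\<^sub>R f w) \<le> ennreal c * sup_norm M f"
  unfolding sup_norm_le_iff using assms
  by (auto simp: ennreal_mult intro!: mult_left_mono cmod_le_sup_norm)

lemma polyproduct_in_cont_space:
  "f \<in> cont_space M \<Longrightarrow> g \<in> cont_space M \<Longrightarrow> polyproduct p1 p2 lam mu f g \<in> cont_space M"
  unfolding cont_space_def polyproduct_def
  by (auto intro!: continuous_intros)

text \<open>The definition of \<open>op_norm\<close> tests only the unit ball; a general
  \<open>h\<close> is rescaled to norm 1, which requires its norm to be finite and nonzero.\<close>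

lemma sup_norm_polyproduct_le:
  assumes "compact M" and h: "h \<in> cont_space M"
  shows "sup_norm M (polyproduct p1 p2 lam mu f h) \<le> op_norm p1 p2 lam mu M f * sup_norm M h"
proof -
  obtain a where a: "0 \<le> a" "sup_norm M h = ennreal a" using sup_norm_finite assms by metis
  show ?thesis
  proof (cases "a = 0")
    case True
    \<comment> \<open>Here \<open>h\<close> cannot be normalised, but it vanishes on
      \<open>M\<close>, and so does the product.\<close>
    have "h w = 0" if "w \<in> M" for w
      using cmod_le_sup_norm[OF that, of h] by (simp add: a True vec_eq_iff)
    then have "polyproduct p1 p2 lam mu f h w = 0" if "w \<in> M" for w
      using that matprod_scaleR_right[of _ _ _ _ _ 0 0] by (simp add: polyproduct_eq_matprod)
    then have "sup_norm M (polyproduct p1 p2 lam mu f h) \<le> 0"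
      unfolding sup_norm_le_iff by simp
    then show ?thesis by simp
  next
    case False
    define g where "g = (\<lambda>w. inverse a *\<^sub>R h w)"
    have "sup_norm M g \<le> ennreal (inverse a) * ennreal a"
      unfolding g_def a(2)[symmetric] by (rule sup_norm_scaleR_le) (simp add: a)
    also have "\<dots> = 1" using a False by (simp flip: ennreal_mult)
    finally have "g \<in> {g \<in> cont_space M. sup_norm M g \<le> 1}"
      using h by (auto simp: g_def cont_space_def intro!: continuous_intros)
    then have g: "sup_norm M (polyproduct p1 p2 lam mu f g) \<le> op_norm p1 p2 lam mu M f"
      unfolding op_norm_def by (rule SUP_upper)
    have "h = (\<lambda>w. a *\<^sub>R g w)" using False by (simp add: g_def)
    then have "polyproduct p1 p2 lam mu f h = (\<lambda>w. a *\<^sub>R polyproduct p1 p2 lam mu f g w)"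
      by (simp add: fun_eq_iff polyproduct_eq_matprod matprod_scaleR_right)
    then have "sup_norm M (polyproduct p1 p2 lam mu f h)
        \<le> ennreal a * sup_norm M (polyproduct p1 p2 lam mu f g)"
      using sup_norm_scaleR_le[OF a(1)] by metis
    also have "\<dots> \<le> ennreal a * op_norm p1 p2 lam mu M f" by (rule mult_left_mono[OF g]) simp
    finally show ?thesis by (simp add: a(2) mult.commute)
  qed
qed

text \<open>Associativity turns the product of \<open>f\<close> and \<open>g\<close>, applied to a
  test function \<open>h\<close>, into \<open>f\<close> applied to the product of \<open>g\<close>
  and \<open>h\<close>, so the two operator norms can be used in succession.\<close>

lemma op_norm_polyproduct_le:
  fixes f g :: "complex \<times> complex \<Rightarrow> complex ^ 'n::finite ^ 'm::finite"
  assumes "simple_roots p1 lam" "simple_roots p2 mu" "compact M" "g \<in> cont_space M"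
  shows "op_norm p1 p2 lam mu M (polyproduct p1 p2 lam mu f g)
    \<le> op_norm p1 p2 lam mu M f * op_norm p1 p2 lam mu M g"
  unfolding op_norm_def[of p1 p2 lam mu M "polyproduct p1 p2 lam mu f g"]
proof (rule SUP_least)
  fix h :: "complex \<times> complex \<Rightarrow> complex ^ 'n ^ 'm"
  assume "h \<in> {h \<in> cont_space M. sup_norm M h \<le> 1}"
  then have h: "h \<in> cont_space M" "sup_norm M h \<le> 1" by auto
  let ?P = "polyproduct p1 p2 lam mu"
  have "?P (?P f g) h = ?P f (?P g h)"
    using matprod_assoc[OF assms(1,2)] by (simp add: fun_eq_iff polyproduct_eq_matprod)
  then have "sup_norm M (?P (?P f g) h) \<le> op_norm p1 p2 lam mu M f * sup_norm M (?P g h)"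
    using sup_norm_polyproduct_le[OF assms(3) polyproduct_in_cont_space[OF assms(4) h(1)]] by metis
  also have "sup_norm M (?P g h) \<le> op_norm p1 p2 lam mu M g"
    unfolding op_norm_def using h by (intro SUP_upper) auto
  finally show "sup_norm M (?P (?P f g) h) \<le> op_norm p1 p2 lam mu M f * op_norm p1 p2 lam mu M g"
    by (simp add: mult_left_mono)
qed

lemma sup_norm_le_op_norm: "sup_norm M f \<le> op_norm p1 p2 lam mu M f"
proof -
  let ?e = "\<lambda>w. \<chi> j k. 1"
  \<comment> \<open>The matrix with all entries 1 is the unit of the polyproduct, and it is an
    admissible test function.\<close>
  have "?e \<in> {g \<in> cont_space M. sup_norm M g \<le> 1}"
    by (simp add: cont_space_def sup_norm_le_iff)
  then have "sup_norm M (polyproduct p1 p2 lam mu f ?e) \<le> op_norm p1 p2 lam mu M f"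
    unfolding op_norm_def by (rule SUP_upper)
  then show ?thesis
    by (simp add: polyproduct_eq_matprod[abs_def] matprod_one_right)
qed

lemma op_norm_le:
  fixes f :: "complex \<times> complex \<Rightarrow> complex ^ 'n::finite ^ 'm::finite"
  assumes "compact M" "f \<in> cont_space M"
    and "\<And>j l. cmod (sigma p1 lam j l) \<le> B1" "\<And>k m. cmod (sigma p2 mu k m) \<le> B2"
    and "\<And>w. w \<in> M \<Longrightarrow> cmod (fst w) \<le> R1 \<and> cmod (snd w) \<le> R2"
    and C: "C = (1 + 4 * R1 * CARD('m) * B1) * (1 + 4 * R2 * CARD('n) * B2)" "0 \<le> C"
  shows "op_norm p1 p2 lam mu M f \<le> ennreal C * sup_norm M f"
  unfolding op_norm_def
proof (rule SUP_least)
  fix g :: "complex \<times> complex \<Rightarrow> complex ^ 'n ^ 'm"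
  assume g: "g \<in> {g \<in> cont_space M. sup_norm M g \<le> 1}"
  obtain a where a: "0 \<le> a" "sup_norm M f = ennreal a" using sup_norm_finite assms(1,2) by metis
  have "cmod (polyproduct p1 p2 lam mu f g w $ j $ k) \<le> C * a" if w: "w \<in> M" for w j k
  proof -
    have "cmod (f w $ j $ k) \<le> a" for j k
      using cmod_le_sup_norm[OF w, of f j k] a by simp
    moreover have "cmod (g w $ j $ k) \<le> 1" for j k
      using g w by (auto simp: sup_norm_le_iff simp flip: ennreal_1)
    ultimately show ?thesis
      using cmod_matprod_le[of "sigma p1 lam" B1 "sigma p2 mu" B2 "fst w" R1 "snd w" R2 "f w" a "g w" 1]
        assms(3,4) assms(5)[OF w] by (simp add: polyproduct_eq_matprod C(1))
  qed
  then show "sup_norm M (polyproduct p1 p2 lam mu f g) \<le> ennreal C * sup_norm M f"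
    using a C(2) by (simp add: sup_norm_le_iff ennreal_leI flip: ennreal_mult)
qed

theorem proposition2p12:
  fixes M1 M2 \<Lambda>1 \<Lambda>2 :: "complex set"
  assumes "compact M1" and "compact M2"
  shows "\<exists>C::real. 0 \<le> C \<and>
    (\<forall>(p1 :: complex poly) (p2 :: complex poly)
      (lam :: 'm::finite \<Rightarrow> complex) (mu :: 'n::finite \<Rightarrow> complex).
      lead_coeff p1 = 1 \<and> degree p1 = CARD('m) \<and> inj lam \<and> range lam = \<Lambda>1 \<and> {z. poly p1 z = 0} = \<Lambda>1 \<and>
      lead_coeff p2 = 1 \<and> degree p2 = CARD('n) \<and> inj mu \<and> range mu = \<Lambda>2 \<and> {z. poly p2 z = 0} = \<Lambda>2
      \<longrightarrow>
      (\<forall>f \<in> cont_space (M1 \<times> M2). \<forall>g \<in> cont_space (M1 \<times> M2).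
        op_norm p1 p2 lam mu (M1 \<times> M2) (polyproduct p1 p2 lam mu f g)
          \<le> op_norm p1 p2 lam mu (M1 \<times> M2) f * op_norm p1 p2 lam mu (M1 \<times> M2) g \<and>
        sup_norm (M1 \<times> M2) f \<le> op_norm p1 p2 lam mu (M1 \<times> M2) f \<and>
        op_norm p1 p2 lam mu (M1 \<times> M2) f \<le> ennreal C * sup_norm (M1 \<times> M2) f))"
proof -
  \<comment> \<open>All four bounds are fixed before \<open>p1\<close>, \<open>p2\<close>,
    \<open>lam\<close> and \<open>mu\<close> are introduced, which makes \<open>C\<close> uniform in
    them.\<close>
  obtain B1 where B1: "0 \<le> B1" "\<And>p (r :: 'm \<Rightarrow> complex) j l.
      simple_roots p r \<Longrightarrow> range r = \<Lambda>1 \<Longrightarrow> cmod (sigma p r j l) \<le> B1"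
    using sigma_bounded[where ?'i = 'm] by metis
  obtain B2 where B2: "0 \<le> B2" "\<And>p (r :: 'n \<Rightarrow> complex) j l.
      simple_roots p r \<Longrightarrow> range r = \<Lambda>2 \<Longrightarrow> cmod (sigma p r j l) \<le> B2"
    using sigma_bounded[where ?'i = 'n] by metis
  obtain R1 where R1: "0 < R1" "\<And>w. w \<in> M1 \<Longrightarrow> cmod w \<le> R1"
    using compact_imp_bounded[OF assms(1)] by (auto simp: bounded_pos)
  obtain R2 where R2: "0 < R2" "\<And>w. w \<in> M2 \<Longrightarrow> cmod w \<le> R2"
    using compact_imp_bounded[OF assms(2)] by (auto simp: bounded_pos)
  have M: "compact (M1 \<times> M2)" using assms by (rule compact_Times)
  define C where "C = (1 + 4 * R1 * CARD('m) * B1) * (1 + 4 * R2 * CARD('n) * B2)"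
  have C: "0 \<le> C" using B1(1) B2(1) R1(1) R2(1) by (simp add: C_def)
  show ?thesis
  proof (intro exI[of _ C] conjI allI impI ballI C)
    fix p1 p2 and lam :: "'m \<Rightarrow> complex" and mu :: "'n \<Rightarrow> complex"
      and f g :: "complex \<times> complex \<Rightarrow> complex ^ 'n ^ 'm"
    assume *: "lead_coeff p1 = 1 \<and> degree p1 = CARD('m) \<and> inj lam \<and> range lam = \<Lambda>1 \<and>
      {z. poly p1 z = 0} = \<Lambda>1 \<and> lead_coeff p2 = 1 \<and> degree p2 = CARD('n) \<and> inj mu \<and>
      range mu = \<Lambda>2 \<and> {z. poly p2 z = 0} = \<Lambda>2"
      and f: "f \<in> cont_space (M1 \<times> M2)" and g: "g \<in> cont_space (M1 \<times> M2)"
    have sr: "simple_roots p1 lam" "simple_roots p2 mu"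
      using * by (auto simp: simple_roots_def)
    show "op_norm p1 p2 lam mu (M1 \<times> M2) (polyproduct p1 p2 lam mu f g)
        \<le> op_norm p1 p2 lam mu (M1 \<times> M2) f * op_norm p1 p2 lam mu (M1 \<times> M2) g"
      by (rule op_norm_polyproduct_le[OF sr M g])
    show "sup_norm (M1 \<times> M2) f \<le> op_norm p1 p2 lam mu (M1 \<times> M2) f"
      by (rule sup_norm_le_op_norm)
    show "op_norm p1 p2 lam mu (M1 \<times> M2) f \<le> ennreal C * sup_norm (M1 \<times> M2) f"
      using B1(2)[OF sr(1)] B2(2)[OF sr(2)] R1(2) R2(2) * C
      by (intro op_norm_le[OF M f, of p1 lam B1 p2 mu B2 R1 R2]) (auto simp: C_def)
  qed
qed

end
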